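(* If $\models_{\mathbf{A}} S$ for a labelled sequent $S$, then $S$ is derivable in $\mathbf{GA_l}$.
   Context: Formulas are built from propositional variables and $t$ using $+,\to,\Rightarrow$ (binary) and $\lnot$; under a valuation $v$ into $\mathbb{Q}$: $v(t)=0$, $v(A+B)=v(A)+v(B)$, $v(\lnot A)=-v(A)$, $v(A\to B)=v(B)-v(A)$, $v(A\Rightarrow B)=\min(0,v(B)-v(A))$ (i.e. $A\Rightarrow B=(A\to B)\land t$). Labels are generated from the unit label $1$ and atomic labels $x_1,x_2,\ldots$ by concatenation $xy$. A labelled formula is $x:A$ with $x$ a label; a labelled sequent $\Gamma\vdash\Delta$ is a pair of finite multisets of labelled formulas. A labelling function $f$ maps labels to $\{0,1\}$ with $f(1)=1$ and $f(xy)=f(x)f(y)$; $f(\Gamma)$ is the multiset $\{A : x:A\in\Gamma, f(x)=1\}$. $\models_{\mathbf{A}}\Gamma\vdash\Delta$ means: for every valuation $v$ into $\mathbb{Q}$ there is a labelling function $f$ with $\sum_{A\in f(\Gamma)}v(A)\le\sum_{B\in f(\Delta)}v(B)$. Calculus $\mathbf{GA_l}$ (premise(s) / conclusion): $(t,l)$ $\Gamma\vdash\Delta/\Gamma,x:t\vdash\Delta$; $(t,r)$ $\Gamma\vdash\Delta/\Gamma\vdash x:t,\Delta$; $(\lnot,l)$ $\Gamma\vdash x:A,\Delta/\Gamma,x:\lnot A\vdash\Delta$; $(\lnot,r)$ $\Gamma,x:A\vdash\Delta/\Gamma\vdash x:\lnot A,\Delta$; $(+,l)$ $\Gamma,x:A,x:B\vdash\Delta/\Gamma,x:A+B\vdash\Delta$;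 $(+,r)$ $\Gamma\vdash\Delta,x:A,x:B/\Gamma\vdash\Delta,x:A+B$; $(\to,l)$ $\Gamma,x:B\vdash\Delta,x:A/\Gamma,x:A\to B\vdash\Delta$; $(\to,r)$ $\Gamma,x:A\vdash\Delta,x:B/\Gamma\vdash\Delta,x:A\to B$; $(\Rightarrow,l)$ $\Gamma,xy:B\vdash\Delta,xy:A/\Gamma,x:A\Rightarrow B\vdash\Delta$ where $y$ is an atomic label not occurring in the conclusion; $(\Rightarrow,r)$ two premises $\Gamma,x:A\vdash\Delta,x:B$ and $\Gamma\vdash\Delta$, conclusion $\Gamma\vdash\Delta,x:A\Rightarrow B$; (success) axiom $\Gamma\vdash\Delta$ whenever all formulas in $\Gamma,\Delta$ are propositional variables and there exist labelling functions $f_1,\ldots,f_n$ ($n\ge1$) with $\biguplus_{i=1}^n f_i(\Gamma)=\biguplus_{i=1}^n f_i(\Delta)$. *)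

theory Defs
  imports Complex_Main "HOL-Library.Multiset"
begin

datatype fm =
    Var nat
  | Truth  ("\<^bold>t")
  | Plus fm fm  (infixl "\<^bold>+" 75)
  | Neg fm  ("\<^bold>\<not> _" [80] 80)
  | Imp fm fm  (infixr "\<^bold>\<rightarrow>" 70)
  | BImp fm fm  (infixr "\<^bold>\<Rightarrow>" 70)

primrec val :: "(nat \<Rightarrow> rat) \<Rightarrow> fm \<Rightarrow> rat" where
  "val v (Var p) = v p"
| "val v \<^bold>t = 0"
| "val v (A \<^bold>+ B) = val v A + val v B"
| "val v (\<^bold>\<not> A) = - val v A"
| "val v (A \<^bold>\<rightarrow> B) = val v B - val v A"
| "val v (A \<^bold>\<Rightarrow> B) = min 0 (val v B - val v A)"

text \<open>Labels are syntactic terms: concatenation is a free binary operation, not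
  quotiented by any monoid laws.\<close>

datatype label =
    Unit
  | Atom nat
  | Concat label label  (infixl "\<^bold>\<cdot>" 85)

primrec atoms :: "label \<Rightarrow> nat set" where
  "atoms Unit = {}"
| "atoms (Atom i) = {i}"
| "atoms (x \<^bold>\<cdot> y) = atoms x \<union> atoms y"

text \<open>The pair \<open>(x, A)\<close> stands for \<open>x : A\<close>, and \<open>(\<Gamma>, \<Delta>)\<close> for the sequent with
  left-hand side \<open>\<Gamma>\<close> and right-hand side \<open>\<Delta>\<close>.\<close>

type_synonym lfm = "label \<times> fm"
type_synonym sequent = "lfm multiset \<times> lfm multiset"

definition atoms_of :: "lfm multiset \<Rightarrow> nat set" where
  "atoms_of \<Gamma> = (\<Union>p \<in> set_mset \<Gamma>. atoms (fst p))"

definition labelling :: "(label \<Rightarrow> nat) \<Rightarrow> bool" where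
  "labelling f \<longleftrightarrow>
     (\<forall>x. f x \<in> {0, 1}) \<and> f Unit = 1 \<and> (\<forall>x y. f (x \<^bold>\<cdot> y) = f x * f y)"

definition select :: "(label \<Rightarrow> nat) \<Rightarrow> lfm multiset \<Rightarrow> fm multiset" where
  "select f \<Gamma> = image_mset snd (filter_mset (\<lambda>p. f (fst p) = 1) \<Gamma>)"

definition valid :: "sequent \<Rightarrow> bool" where
  "valid S \<longleftrightarrow>
     (\<forall>v. \<exists>f. labelling f \<and>
        (\<Sum>A \<in># select f (fst S). val v A) \<le> (\<Sum>B \<in># select f (snd S). val v B))"

inductive derivable :: "sequent \<Rightarrow> bool" where
  t_l: "derivable (\<Gamma>, \<Delta>) \<Longrightarrow> derivable (\<Gamma> + {#(x, \<^bold>t)#}, \<Delta>)"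
| t_r: "derivable (\<Gamma>, \<Delta>) \<Longrightarrow> derivable (\<Gamma>, \<Delta> + {#(x, \<^bold>t)#})"
| neg_l: "derivable (\<Gamma>, \<Delta> + {#(x, A)#}) \<Longrightarrow> derivable (\<Gamma> + {#(x, \<^bold>\<not> A)#}, \<Delta>)"
| neg_r: "derivable (\<Gamma> + {#(x, A)#}, \<Delta>) \<Longrightarrow> derivable (\<Gamma>, \<Delta> + {#(x, \<^bold>\<not> A)#})"
| plus_l: "derivable (\<Gamma> + {#(x, A), (x, B)#}, \<Delta>) \<Longrightarrow> derivable (\<Gamma> + {#(x, A \<^bold>+ B)#}, \<Delta>)"
| plus_r: "derivable (\<Gamma>, \<Delta> + {#(x, A), (x, B)#}) \<Longrightarrow> derivable (\<Gamma>, \<Delta> + {#(x, A \<^bold>+ B)#})"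
| imp_l: "derivable (\<Gamma> + {#(x, B)#}, \<Delta> + {#(x, A)#}) \<Longrightarrow>
    derivable (\<Gamma> + {#(x, A \<^bold>\<rightarrow> B)#}, \<Delta>)"
| imp_r: "derivable (\<Gamma> + {#(x, A)#}, \<Delta> + {#(x, B)#}) \<Longrightarrow>
    derivable (\<Gamma>, \<Delta> + {#(x, A \<^bold>\<rightarrow> B)#})"
| bimp_l: "\<lbrakk>derivable (\<Gamma> + {#(x \<^bold>\<cdot> Atom y, B)#}, \<Delta> + {#(x \<^bold>\<cdot> Atom y, A)#});
      y \<notin> atoms_of (\<Gamma> + {#(x, A \<^bold>\<Rightarrow> B)#}); y \<notin> atoms_of \<Delta>\<rbrakk> \<Longrightarrow>
    derivable (\<Gamma> + {#(x, A \<^bold>\<Rightarrow> B)#}, \<Delta>)"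
| bimp_r: "\<lbrakk>derivable (\<Gamma> + {#(x, A)#}, \<Delta> + {#(x, B)#}); derivable (\<Gamma>, \<Delta>)\<rbrakk> \<Longrightarrow>
    derivable (\<Gamma>, \<Delta> + {#(x, A \<^bold>\<Rightarrow> B)#})"
| success: "\<lbrakk>\<forall>p \<in># \<Gamma> + \<Delta>. \<exists>q. snd p = Var q;
      (n::nat) \<ge> 1; \<forall>i \<in> {1..n}. labelling (f i);
      (\<Sum>i = 1..n. select (f i) \<Gamma>) = (\<Sum>i = 1..n. select (f i) \<Delta>)\<rbrakk> \<Longrightarrow>
    derivable (\<Gamma>, \<Delta>)"

end

theory Submission
  imports Defs
begin

text \<open>
  Every logical rule is invertible with respect to validity; for \<open>(\<Rightarrow>, l)\<close> the fresh atomic label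
  is switched on exactly when \<open>v(B) \<le> v(A)\<close>. Applying the rules backwards therefore reduces a
  valid sequent to valid sequents of variables. For such a sequent, validity says that no \<open>v\<close> is
  strictly positive on all of the finitely many integer vectors \<open>f(\<Gamma>) - f(\<Delta>)\<close>, so by Gordan's
  theorem of the alternative some nonempty multiset of these vectors sums to zero, which is the
  success condition.
\<close>

section \<open>Gordan's theorem of the alternative\<close>

text \<open>Supplies the value of the eliminated coordinate. If both sets are nonempty, density of
  the field gives a point between \<open>Max L\<close> and \<open>Min U\<close>; an empty side
  imposes no bound and is treated apart, since \<open>Max\<close> and \<open>Min\<close> say nothing
  there.\<close>

lemma between_finite_sets:
  fixes L U :: "'a::linordered_field set"
  assumes "finite L" "finite U" and lt: "\<And>l u. l \<in> L \<Longrightarrow> u \<in> U \<Longrightarrow> l < u"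
  obtains t where "\<And>l. l \<in> L \<Longrightarrow> l < t" and "\<And>u. u \<in> U \<Longrightarrow> t < u"
proof (cases "L = {} \<or> U = {}")
  case True
  then show ?thesis
  proof
    assume "L = {}"
    obtain t where "\<forall>u\<in>U. t < u"
    proof (cases "U = {}")
      case False
      then have "\<forall>u\<in>U. Min U - 1 < u"
        using assms(2) by (meson Min_le diff_less_eq less_add_one order_le_less_trans)
      then show ?thesis using that by blast
    qed (use that in blast)
    then show ?thesis using that \<open>L = {}\<close> by blast
  next
    assume "U = {}"
    obtain t where "\<forall>l\<in>L. l < t"
    proof (cases "L = {}")
      case False
      then have "\<forall>l\<in>L. l < Max L + 1"
        using assms(1) by (meson Max_ge less_add_one order_le_less_trans)
      then show ?thesis using that by blast
    qed (use that in blast)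
    then show ?thesis using that \<open>U = {}\<close> by blast
  qed
next
  case False
  then have "Max L < Min U" using assms by simp
  then obtain t where "Max L < t" "t < Min U" using dense by blast
  then show ?thesis using that[of t] assms(1,2) False by auto
qed

lemma sum_mset_Union_image_mset:
  fixes h :: "'a \<Rightarrow> 'b::comm_monoid_add"
  shows "sum_mset (image_mset h (\<Sum>\<^sub># (image_mset G N))) = (\<Sum>e\<in>#N. sum_mset (image_mset h (G e)))"
  by (induction N) auto

text \<open>Fourier--Motzkin elimination of one coordinate of \<open>v\<close> per induction step.\<close>

lemma gordan_alternative:
  fixes C :: "('b \<Rightarrow> int) set"
  assumes "finite P" "finite C"
    and "\<And>v :: 'b \<Rightarrow> 'a::linordered_field. \<exists>c\<in>C. (\<Sum>p\<in>P. v p * of_int (c p)) \<le> 0"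
  shows "\<exists>M. M \<noteq> {#} \<and> set_mset M \<subseteq> C \<and> (\<forall>p\<in>P. (\<Sum>c\<in>#M. c p) = 0)"
  using assms
proof (induction P arbitrary: C rule: finite_induct)
  case empty
  then obtain c where "c \<in> C" by auto
  then show ?case by (intro exI[of _ "{#c#}"]) auto
next
  case (insert q P)
  define Z where "Z = {c\<in>C. c q = 0}"
  define Pos where "Pos = {c\<in>C. c q > 0}"
  define Neg where "Neg = {c\<in>C. c q < 0}"
  \<comment> \<open>For \<open>c\<close> in \<open>Pos\<close> and \<open>d\<close> in
    \<open>Neg\<close> both coefficients are positive integers, and coordinate \<open>q\<close>
    cancels.\<close>
  define comb where "comb = (\<lambda>(c, d) p. - d q * c p + c q * d p :: int)"
  define D where "D = Z \<union> comb ` (Pos \<times> Neg)"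
  have fin: "finite Pos" "finite Neg" "finite D"
    using insert.prems(1) by (simp_all add: Z_def Pos_def Neg_def D_def)
  have ex: "\<exists>c\<in>D. (\<Sum>p\<in>P. v p * of_int (c p)) \<le> 0" for v :: "'b \<Rightarrow> 'a"
  \<comment> \<open>A \<open>v\<close> strictly positive on all of \<open>D\<close> would extend, by
    a suitable value \<open>t\<close> at \<open>q\<close>, to one strictly positive on all of
    \<open>C\<close>.\<close>
  proof (rule ccontr)
    define s where "s c = (\<Sum>p\<in>P. v p * of_int (c p))" for c :: "'b \<Rightarrow> int"
    assume "\<not> (\<exists>c\<in>D. (\<Sum>p\<in>P. v p * of_int (c p)) \<le> 0)"
    then have pos: "s c > 0" if "c \<in> D" for c using that by (force simp: s_def)
    have s_comb: "s (comb (c, d)) = - of_int (d q) * s c + of_int (c q) * s d" for c d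
      by (simp add: s_def comb_def sum_distrib_left sum.distrib[symmetric] algebra_simps)
    \<comment> \<open>Vectors in \<open>Pos\<close> bound \<open>t\<close> from below, those in
      \<open>Neg\<close> from above. The bounds are compatible because
      \<open>s (comb (c, d))\<close> is positive: divide by \<open>c q\<close> times
      \<open>- d q\<close>.\<close>
    have lt: "- s c / of_int (c q) < - s d / of_int (d q)" if "c \<in> Pos" "d \<in> Neg" for c d
    proof -
      have "s (comb (c, d)) > 0" using that by (intro pos) (auto simp: D_def)
      moreover have "of_int (c q) > (0::'a)" "of_int (d q) < (0::'a)"
        using that by (auto simp: Pos_def Neg_def)
      ultimately show ?thesis unfolding s_comb by (simp add: field_simps)
    qed
    obtain t where t: "\<And>c. c \<in> Pos \<Longrightarrow> - s c / of_int (c q) < t"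
      "\<And>d. d \<in> Neg \<Longrightarrow> t < - s d / of_int (d q)"
      by (rule between_finite_sets[of "(\<lambda>c. - s c / of_int (c q)) ` Pos"
          "(\<lambda>d. - s d / of_int (d q)) ` Neg"]) (use fin lt in blast)+
    have "t * of_int (c q) + s c > 0" if "c \<in> C" for c
    proof (cases "c q" "0::int" rule: linorder_cases)
      case less
      then have "of_int (c q) < (0::'a)" by simp
      then show ?thesis using t(2)[of c] less that by (simp add: Neg_def field_simps)
    next
      case equal
      then show ?thesis using pos[of c] that by (simp add: D_def Z_def)
    next
      case greater
      then have "of_int (c q) > (0::'a)" by simp
      then show ?thesis using t(1)[of c] greater that by (simp add: Pos_def field_simps)
    qed
    moreover have "(\<Sum>p\<in>insert q P. (v(q := t)) p * of_int (c p)) = t * of_int (c q) + s c" for c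
    proof -
      have "(\<Sum>p\<in>P. (v(q := t)) p * of_int (c p)) = s c"
        unfolding s_def using insert.hyps(2) by (intro sum.cong) auto
      then show ?thesis using insert.hyps by simp
    qed
    ultimately show False using insert.prems(2)[of "v(q := t)"] by (metis leD)
  qed
  obtain N where N: "N \<noteq> {#}" "set_mset N \<subseteq> D" "\<forall>p\<in>P. (\<Sum>c\<in>#N. c p) = 0"
    using insert.IH[OF fin(3) ex] by blast
  have "\<exists>M. M \<noteq> {#} \<and> set_mset M \<subseteq> C \<and> (\<forall>p. (\<Sum>c\<in>#M. c p) = e p)" if e: "e \<in> D" for e
  proof (cases "e \<in> Z")
    case True
    then show ?thesis by (intro exI[of _ "{#e#}"]) (auto simp: Z_def)
  next
    case False
    then obtain c d where cd: "c \<in> Pos" "d \<in> Neg" "e = comb (c, d)"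
      using e by (auto simp: D_def)
    \<comment> \<open>The coefficients of \<open>comb\<close> become multiplicities; they are
      positive, so \<open>nat\<close> does not change them.\<close>
    let ?M = "replicate_mset (nat (- d q)) c + replicate_mset (nat (c q)) d"
    from cd show ?thesis by (intro exI[of _ ?M]) (auto simp: Pos_def Neg_def comb_def)
  qed
  then obtain G where G: "\<And>e. e \<in> D \<Longrightarrow> G e \<noteq> {#} \<and> set_mset (G e) \<subseteq> C \<and> (\<forall>p. (\<Sum>c\<in>#G e. c p) = e p)"
    by metis
  have sum_G: "(\<Sum>c\<in># (\<Sum>\<^sub># (image_mset G N)). c p) = (\<Sum>e\<in>#N. e p)" for p
    unfolding sum_mset_Union_image_mset using N(2) G
    by (intro arg_cong[of _ _ sum_mset] image_mset_cong) auto
  \<comment> \<open>The induction hypothesis controls only the coordinates in \<open>P\<close>;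
    coordinate \<open>q\<close> vanishes on every member of \<open>D\<close>.\<close>
  have "e q = 0" if "e \<in> D" for e
    using that by (auto simp: D_def Z_def comb_def)
  then have "(\<Sum>e\<in>#N. e q) = 0"
    using N(2) by (intro sum_mset.neutral) auto
  then show ?case
    using N G by (intro exI[of _ "\<Sum>\<^sub># (image_mset G N)"]) (auto simp: sum_G subset_iff)
qed

section \<open>Invertibility of the rules\<close>

lemma select_empty [simp]: "select f {#} = {#}"
  and select_add_mset [simp]:
    "select f (add_mset (x, A) \<Gamma>) = (if f x = 1 then add_mset A (select f \<Gamma>) else select f \<Gamma>)"
  by (simp_all add: select_def)

lemma select_cong: "(\<And>p. p \<in># \<Gamma> \<Longrightarrow> f (fst p) = g (fst p)) \<Longrightarrow> select f \<Gamma> = select g \<Gamma>"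
  by (auto simp: select_def intro!: arg_cong[of _ _ "image_mset snd"] filter_mset_cong)

lemma finite_atoms: "finite (atoms x)"
  by (induction x) auto

lemma finite_atoms_of: "finite (atoms_of \<Gamma>)"
  by (simp add: atoms_of_def finite_atoms)

text \<open>Labels are free terms, so a 0/1 assignment to the atoms determines a labelling; this is
  that extension.\<close>

primrec label_eval :: "(nat \<Rightarrow> nat) \<Rightarrow> label \<Rightarrow> nat" where
  "label_eval g Unit = 1"
| "label_eval g (Atom i) = g i"
| "label_eval g (x \<^bold>\<cdot> y) = label_eval g x * label_eval g y"

lemma labelling_label_eval:
  assumes "\<And>i. g i \<in> {0, 1}"
  shows "labelling (label_eval g)"
proof -
  have "label_eval g x \<in> {0, 1}" for x
    using assms by (induction x) auto
  then show ?thesis by (simp add: labelling_def)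
qed

text \<open>Overriding \<open>f\<close> only at the label \<open>Atom y\<close> could break
  multiplicativity, so the value is changed in the assignment to atoms and all labels are
  re-evaluated.\<close>

lemma labelling_update_atom:
  assumes f: "labelling f" and b: "b \<in> {0, 1}"
  obtains f' where "labelling f'" "f' (Atom y) = b" "\<And>x. y \<notin> atoms x \<Longrightarrow> f' x = f x"
proof
  let ?g = "(\<lambda>i. f (Atom i))(y := b)"
  show "labelling (label_eval ?g)"
    using assms by (intro labelling_label_eval) (auto simp: labelling_def)
  show "label_eval ?g (Atom y) = b" by simp
  show "label_eval ?g x = f x" if "y \<notin> atoms x" for x
    using that f by (induction x) (auto simp: labelling_def)
qed

text \<open>Freshness keeps all other selections unchanged. If \<open>x\<close> is selected, the new
  pair contributes \<open>val v B - val v A\<close> when this is at most 0 and nothing otherwise,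
  which is the value \<open>min 0 (val v B - val v A)\<close> of the principal formula.\<close>

lemma valid_bimp_l:
  assumes valid: "valid (\<Gamma> + {#(x, A \<^bold>\<Rightarrow> B)#}, \<Delta>)"
    and y: "y \<notin> atoms_of (\<Gamma> + {#(x, A \<^bold>\<Rightarrow> B)#})" "y \<notin> atoms_of \<Delta>"
  shows "valid (\<Gamma> + {#(x \<^bold>\<cdot> Atom y, B)#}, \<Delta> + {#(x \<^bold>\<cdot> Atom y, A)#})"
  unfolding valid_def
proof
  fix v
  obtain f where f: "labelling f"
    "(\<Sum>A \<in># select f (\<Gamma> + {#(x, A \<^bold>\<Rightarrow> B)#}). val v A) \<le> (\<Sum>B \<in># select f \<Delta>. val v B)"
    using valid by (auto simp: valid_def)
  obtain f' where f': "labelling f'" "f' (Atom y) = (if val v B \<le> val v A then 1 else 0)"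
    "\<And>z. y \<notin> atoms z \<Longrightarrow> f' z = f z"
    by (rule labelling_update_atom[OF f(1), of "if val v B \<le> val v A then 1 else 0" y]) auto
  have "select f' \<Gamma> = select f \<Gamma>" "select f' \<Delta> = select f \<Delta>" "f' x = f x"
    using y f'(3) by (auto simp: atoms_of_def intro!: select_cong)
  moreover have "f' (x \<^bold>\<cdot> Atom y) = f' x * f' (Atom y)"
    using f'(1) by (simp add: labelling_def)
  ultimately show "\<exists>f. labelling f \<and>
      (\<Sum>A\<in>#select f (fst (\<Gamma> + {#(x \<^bold>\<cdot> Atom y, B)#}, \<Delta> + {#(x \<^bold>\<cdot> Atom y, A)#})). val v A)
      \<le> (\<Sum>B\<in>#select f (snd (\<Gamma> + {#(x \<^bold>\<cdot> Atom y, B)#}, \<Delta> + {#(x \<^bold>\<cdot> Atom y, A)#})). val v B)"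
    using f(2) f'(1,2) by (intro exI[of _ f']) (auto split: if_splits)
qed

text \<open>For rules without a fresh label the witness \<open>f\<close> carries over unchanged.\<close>

lemma valid_mono:
  assumes "valid (\<Gamma>, \<Delta>)"
    and "\<And>f v. (\<Sum>B\<in>#select f \<Delta>. val v B) - (\<Sum>A\<in>#select f \<Gamma>. val v A)
      \<le> (\<Sum>B\<in>#select f \<Delta>'. val v B) - (\<Sum>A\<in>#select f \<Gamma>'. val v A)"
  shows "valid (\<Gamma>', \<Delta>')"
  unfolding valid_def
proof
  fix v
  obtain f where "labelling f" "(\<Sum>A \<in># select f \<Gamma>. val v A) \<le> (\<Sum>B \<in># select f \<Delta>. val v B)"
    using assms(1) by (auto simp: valid_def)
  then show "\<exists>f. labelling f \<and>
      (\<Sum>A\<in>#select f (fst (\<Gamma>', \<Delta>')). val v A) \<le> (\<Sum>B\<in>#select f (snd (\<Gamma>', \<Delta>')). val v B)"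
    using assms(2)[where f = f and v = v] by (intro exI[of _ f]) auto
qed

section \<open>Sequents of variables\<close>

lemma sum_mset_eq_sum_count:
  fixes g :: "'b \<Rightarrow> 'a::comm_ring_1"
  assumes "finite P" "set_mset M \<subseteq> P"
  shows "(\<Sum>A\<in>#M. g A) = (\<Sum>A\<in>P. g A * of_nat (count M A))"
  using assms(2)
proof (induction M)
  case (add B M)
  have "(\<Sum>A\<in>P. g A * of_nat (count (add_mset B M) A))
      = (\<Sum>A\<in>P. g A * of_nat (count M A) + (if A = B then g B else 0))"
    by (intro sum.cong) (auto simp: algebra_simps)
  also have "\<dots> = (\<Sum>A\<in>P. g A * of_nat (count M A)) + g B"
    using add.prems assms(1) by (simp add: sum.distrib)
  finally show ?case using add by simp
qed simp

text \<open>A selection depends only on which of the finitely many labelled formulas have a label of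
  value 1. Hence the labellings, though infinite in number, yield the finite set of vectors that
  Gordan's theorem requires.\<close>

lemma finite_range_select: "finite (range (\<lambda>f. (select f \<Gamma>, select f \<Delta>)))"
proof -
  let ?sel = "\<lambda>X \<Gamma>. image_mset snd (filter_mset (\<lambda>p. p \<in> X) \<Gamma>)"
  have "(select f \<Gamma>, select f \<Delta>) \<in> (\<lambda>X. (?sel X \<Gamma>, ?sel X \<Delta>)) ` Pow (set_mset (\<Gamma> + \<Delta>))" for f
    by (rule image_eqI[where x = "{p \<in> set_mset (\<Gamma> + \<Delta>). f (fst p) = 1}"])
      (auto simp: select_def intro!: arg_cong[of _ _ "image_mset snd"] filter_mset_cong)
  then have "range (\<lambda>f. (select f \<Gamma>, select f \<Delta>))
      \<subseteq> (\<lambda>X. (?sel X \<Gamma>, ?sel X \<Delta>)) ` Pow (set_mset (\<Gamma> + \<Delta>))" by blast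
  then show ?thesis by (rule finite_subset) simp
qed

lemma derivable_if_valid_vars:
  assumes valid: "valid (\<Gamma>, \<Delta>)" and vars: "\<forall>p \<in># \<Gamma> + \<Delta>. \<exists>q. snd p = Var q"
  shows "derivable (\<Gamma>, \<Delta>)"
proof -
  define P where "P = snd ` set_mset (\<Gamma> + \<Delta>)"
  define vec where "vec = (\<lambda>f A. int (count (select f \<Gamma>) A) - int (count (select f \<Delta>) A))"
  define C where "C = vec ` {f. labelling f}"
  have finP: "finite P" by (simp add: P_def)
  have sub: "set_mset (select f \<Gamma>) \<subseteq> P" "set_mset (select f \<Delta>) \<subseteq> P" for f
    by (auto simp: select_def P_def)
  have "C \<subseteq> (\<lambda>(M, N) A. int (count M A) - int (count N A)) ` range (\<lambda>f. (select f \<Gamma>, select f \<Delta>))"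
    by (auto simp: C_def vec_def image_image)
  then have finC: "finite C"
    using finite_range_select by (meson finite_imageI finite_subset)
  have ex: "\<exists>c\<in>C. (\<Sum>A\<in>P. w A * of_int (c A)) \<le> 0" for w :: "fm \<Rightarrow> rat"
  proof -
    \<comment> \<open>Gordan's theorem allows arbitrary weights on formulas; on \<open>P\<close>,
      which contains only variables, these agree with a valuation.\<close>
    let ?v = "\<lambda>q. w (Var q)"
    obtain f where f: "labelling f"
      "(\<Sum>A \<in># select f \<Gamma>. val ?v A) \<le> (\<Sum>B \<in># select f \<Delta>. val ?v B)"
      using valid by (auto simp: valid_def)
    have w: "val ?v A = w A" if "A \<in> P" for A using that vars by (force simp: P_def)
    have "(\<Sum>A\<in>P. val ?v A * of_int (vec f A))
        = (\<Sum>A \<in># select f \<Gamma>. val ?v A) - (\<Sum>B \<in># select f \<Delta>. val ?v B)"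
      unfolding sum_mset_eq_sum_count[OF finP sub(1)] sum_mset_eq_sum_count[OF finP sub(2)]
      by (simp add: vec_def sum_subtractf[symmetric] algebra_simps)
    then have "(\<Sum>A\<in>P. w A * of_int (vec f A)) \<le> 0" using f(2) by (simp add: w)
    then show ?thesis using f(1) by (auto simp: C_def)
  qed
  obtain M where M: "M \<noteq> {#}" "set_mset M \<subseteq> C" "\<forall>A\<in>P. (\<Sum>c\<in>#M. c A) = 0"
    using gordan_alternative[OF finP finC ex] by blast
  obtain cs where cs: "mset cs = M" using ex_mset by blast
  have "\<forall>c\<in>C. \<exists>f. labelling f \<and> c = vec f" by (auto simp: C_def)
  then obtain lab where lab: "\<And>c. c \<in> C \<Longrightarrow> labelling (lab c) \<and> c = vec (lab c)" by metis
  \<comment> \<open>The success rule numbers labellings from 1, lists from 0. Repeated vectors in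
    \<open>M\<close> give repeated labellings.\<close>
  define f where "f i = lab (cs ! (i - 1))" for i
  have nth: "cs ! (i - 1) \<in> C" if "i \<in> {1..length cs}" for i
    using that M(2) cs by (auto intro!: nth_mem)
  show ?thesis
  proof (rule success)
    show "\<forall>p \<in># \<Gamma> + \<Delta>. \<exists>q. snd p = Var q" by (fact vars)
    show "length cs \<ge> 1" using M(1) cs by (cases cs) auto
    show "\<forall>i \<in> {1..length cs}. labelling (f i)" using nth lab by (simp add: f_def)
    show "(\<Sum>i = 1..length cs. select (f i) \<Gamma>) = (\<Sum>i = 1..length cs. select (f i) \<Delta>)"
    proof (rule multiset_eqI)
      fix A
      show "count (\<Sum>i = 1..length cs. select (f i) \<Gamma>) A = count (\<Sum>i = 1..length cs. select (f i) \<Delta>) A"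
      proof (cases "A \<in> P")
        case True
        have "(\<Sum>c\<in>#M. c A) = (\<Sum>i<length cs. (cs ! i) A)"
          unfolding cs[symmetric]
          by (simp add: sum_mset_sum_list sum_list_sum_nth atLeast0LessThan flip: mset_map)
        also have "\<dots> = (\<Sum>i = 1..length cs. (cs ! (i - 1)) A)"
          by (rule sum.reindex_bij_witness[of _ "\<lambda>i. i - 1" Suc]) auto
        also have "\<dots> = (\<Sum>i = 1..length cs. vec (f i) A)"
          using nth lab by (intro sum.cong) (auto simp: f_def dest: fun_cong)
        finally have "(\<Sum>i = 1..length cs. int (count (select (f i) \<Gamma>) A))
            = (\<Sum>i = 1..length cs. int (count (select (f i) \<Delta>) A))"
          using M(3) True by (simp add: vec_def sum_subtractf)
        then show ?thesis by (simp add: count_sum flip: of_nat_sum)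
      next
        \<comment> \<open>Gordan's theorem says nothing outside \<open>P\<close>, but no formula
          there is ever selected.\<close>
        case False
        then have "count (select f \<Gamma>) A = 0" "count (select f \<Delta>) A = 0" for f
          using sub by (auto simp: count_eq_zero_iff)
        then show ?thesis by (simp add: count_sum)
      qed
    qed
  qed
qed

section \<open>Completeness\<close>

text \<open>\<open>Var\<close> and \<open>\<^bold>t\<close> have size 0, so the factor 2 is needed for the rules for \<open>\<^bold>+\<close> and \<open>\<^bold>\<rightarrow>\<close>,
  which split one formula in two, and the summand 1 for those that delete \<open>\<^bold>t\<close>.\<close>

definition complexity :: "lfm multiset \<Rightarrow> nat" where
  "complexity \<Gamma> = (\<Sum>p\<in>#\<Gamma>. 2 * size (snd p) + 1)"

lemma complexity_simps [simp]:
  "complexity {#} = 0"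
  "complexity (add_mset p \<Gamma>) = 2 * size (snd p) + 1 + complexity \<Gamma>"
  by (simp_all add: complexity_def)

text \<open>Any non-variable formula may be decomposed first, since each rule preserves validity
  from conclusion to premises. The measure ignores labels, so the longer label introduced by
  \<open>bimp_l\<close> does no harm.\<close>

lemma valid_imp_derivable: "valid (\<Gamma>, \<Delta>) \<Longrightarrow> derivable (\<Gamma>, \<Delta>)"
proof (induction "complexity \<Gamma> + complexity \<Delta>" arbitrary: \<Gamma> \<Delta> rule: less_induct)
  case less
  note IH = less.hyps and valid = less.prems
  consider "\<forall>p \<in># \<Gamma> + \<Delta>. \<exists>q. snd p = Var q"
    | x A \<Gamma>' where "\<Gamma> = \<Gamma>' + {#(x, A)#}" "\<nexists>q. A = Var q"
    | x A \<Delta>' where "\<Delta> = \<Delta>' + {#(x, A)#}" "\<nexists>q. A = Var q"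
    by (metis add_mset_add_single insert_DiffM prod.collapse union_iff)
  then show ?case
  proof cases
    case 1
    with valid show ?thesis by (rule derivable_if_valid_vars)
  next
    case (2 x A \<Gamma>')
    note valid = valid[unfolded 2(1)]
    show ?thesis
    proof (cases A)
      case (Var q)
      with 2 show ?thesis by simp
    next
      case Truth
      have "derivable (\<Gamma>', \<Delta>)"
        by (intro IH valid_mono[OF valid]) (simp_all add: 2 Truth)
      then show ?thesis unfolding 2 Truth by (rule t_l)
    next
      case (Plus B C)
      have "derivable (\<Gamma>' + {#(x, B), (x, C)#}, \<Delta>)"
        by (intro IH valid_mono[OF valid]) (simp_all add: 2 Plus)
      then show ?thesis unfolding 2 Plus by (rule plus_l)
    next
      case (Neg B)
      have "derivable (\<Gamma>', \<Delta> + {#(x, B)#})"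
        by (intro IH valid_mono[OF valid]) (simp_all add: 2 Neg)
      then show ?thesis unfolding 2 Neg by (rule neg_l)
    next
      case (Imp B C)
      have "derivable (\<Gamma>' + {#(x, C)#}, \<Delta> + {#(x, B)#})"
        by (intro IH valid_mono[OF valid]) (simp_all add: 2 Imp)
      then show ?thesis unfolding 2 Imp by (rule imp_l)
    next
      case (BImp B C)
      obtain y where "y \<notin> atoms_of (\<Gamma>' + {#(x, B \<^bold>\<Rightarrow> C)#}) \<union> atoms_of \<Delta>"
        using ex_new_if_finite[OF infinite_UNIV_nat] finite_atoms_of by (metis finite_UnI)
      then have y: "y \<notin> atoms_of (\<Gamma>' + {#(x, B \<^bold>\<Rightarrow> C)#})" "y \<notin> atoms_of \<Delta>" by auto
      have "derivable (\<Gamma>' + {#(x \<^bold>\<cdot> Atom y, C)#}, \<Delta> + {#(x \<^bold>\<cdot> Atom y, B)#})"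
        by (intro IH valid_bimp_l[OF valid[unfolded BImp] y]) (simp add: 2 BImp)
      then show ?thesis unfolding 2 BImp using y by (rule bimp_l)
    qed
  next
    case (3 x A \<Delta>')
    note valid = valid[unfolded 3(1)]
    show ?thesis
    proof (cases A)
      case (Var q)
      with 3 show ?thesis by simp
    next
      case Truth
      have "derivable (\<Gamma>, \<Delta>')"
        by (intro IH valid_mono[OF valid]) (simp_all add: 3 Truth)
      then show ?thesis unfolding 3 Truth by (rule t_r)
    next
      case (Plus B C)
      have "derivable (\<Gamma>, \<Delta>' + {#(x, B), (x, C)#})"
        by (intro IH valid_mono[OF valid]) (simp_all add: 3 Plus)
      then show ?thesis unfolding 3 Plus by (rule plus_r)
    next
      case (Neg B)
      have "derivable (\<Gamma> + {#(x, B)#}, \<Delta>')"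
        by (intro IH valid_mono[OF valid]) (simp_all add: 3 Neg)
      then show ?thesis unfolding 3 Neg by (rule neg_r)
    next
      case (Imp B C)
      have "derivable (\<Gamma> + {#(x, B)#}, \<Delta>' + {#(x, C)#})"
        by (intro IH valid_mono[OF valid]) (simp_all add: 3 Imp)
      then show ?thesis unfolding 3 Imp by (rule imp_r)
    next
      case (BImp B C)
      \<comment> \<open>The minimum is bounded by each of its two arguments:
        \<open>val v C - val v B\<close> gives this premise, and 0 gives the other.\<close>
      have "derivable (\<Gamma> + {#(x, B)#}, \<Delta>' + {#(x, C)#})"
        by (intro IH valid_mono[OF valid]) (simp_all add: 3 BImp min_def)
      moreover have "derivable (\<Gamma>, \<Delta>')"
        by (intro IH valid_mono[OF valid]) (simp_all add: 3 BImp)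
      ultimately show ?thesis unfolding 3 BImp by (rule bimp_r)
    qed
  qed
qed

theorem mainTheorem14:
  fixes S :: sequent
  assumes "valid S"
  shows "derivable S"
  using valid_imp_derivable[of "fst S" "snd S"] assms by simp

end
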